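(* Let $X$ be a set equipped with a binary operation $\ast$ and a distinguished element $0 \in X$. Then the following two conditions are equivalent: (1) For all $x, y, z \in X$: (B1) $x \ast x = 0$; (B2) if $x \ast y = 0$ and $y \ast x = 0$ then $x = y$; (B3) $(x \ast y) \ast z = (x \ast z) \ast y$. (2) For all $x, y, z \in X$: (G) $((x \ast y) \ast z) \ast ((x \ast (z \ast 0)) \ast y) = 0$; (A3) if $x \ast y = 0$ and $y \ast x = 0$ then $x = y$. In particular, $\{G, A3\}$ axiomatizes exactly the class of BCH-algebras.
   Context: An algebra of type $(2,0)$ is a set $X$ with a binary operation $\ast$ and a constant $0$. A BCH-algebra is such an algebra satisfying, for all $x,y,z$, the axioms (B1) $x\ast x=0$, (B2) $x\ast y=0$ and $y\ast x=0$ imply $x=y$, and (B3) $(x\ast y)\ast z=(x\ast z)\ast y$. *)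

theory Defs
  imports Main
begin

locale algebra_2_0 =
  fixes X :: "'a set"
    and star :: "'a \<Rightarrow> 'a \<Rightarrow> 'a"  (infixl \<open>\<star>\<close> 70)
    and zero :: 'a  (\<open>\<zero>\<close>)
  assumes star_closed: "x \<in> X \<Longrightarrow> y \<in> X \<Longrightarrow> x \<star> y \<in> X"
    and zero_closed: "\<zero> \<in> X"

locale BCH_algebra = algebra_2_0 +
  assumes B1: "x \<in> X \<Longrightarrow> x \<star> x = \<zero>"
    and B2: "x \<in> X \<Longrightarrow> y \<in> X \<Longrightarrow> x \<star> y = \<zero> \<Longrightarrow> y \<star> x = \<zero> \<Longrightarrow> x = y"
    and B3: "x \<in> X \<Longrightarrow> y \<in> X \<Longrightarrow> z \<in> X \<Longrightarrow> (x \<star> y) \<star> z = (x \<star> z) \<star> y"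

locale GA3_algebra = algebra_2_0 +
  assumes G: "x \<in> X \<Longrightarrow> y \<in> X \<Longrightarrow> z \<in> X \<Longrightarrow>
      ((x \<star> y) \<star> z) \<star> ((x \<star> (z \<star> \<zero>)) \<star> y) = \<zero>"
    and A3: "x \<in> X \<Longrightarrow> y \<in> X \<Longrightarrow> x \<star> y = \<zero> \<Longrightarrow> y \<star> x = \<zero> \<Longrightarrow> x = y"

end

theory Submission
  imports Defs
begin

text \<open>
  Everything hinges on the identity \<open>x \<star> \<zero> = x\<close>: in its presence (G) says that
  \<open>(x \<star> y) \<star> z\<close> lies below \<open>(x \<star> z) \<star> y\<close> for the relation \<open>a \<star> b = \<zero>\<close>, so that
  antisymmetry yields (B3), and \<open>y = z = \<zero>\<close> yields (B1).

  To get the identity from (G) and (A3), write \<open>x'\<close> for \<open>x \<star> \<zero>\<close>. One first obtains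
  \<open>\<zero>' = \<zero>\<close>, then \<open>(x \<star> y) \<star> (x' \<star> y) = \<zero>\<close>, then \<open>x''' \<star> x = \<zero>\<close>. The last equation
  shows that \<open>w' = \<zero>\<close> implies \<open>w = \<zero>\<close>, which upgrades \<open>(x \<star> x'')' = (x'' \<star> x)' = \<zero>\<close>
  to \<open>x'' = x\<close>; then \<open>x' \<star> x\<close> and \<open>x \<star> x'\<close> both vanish.
\<close>

context BCH_algebra
begin

lemma star_zero: "x \<star> \<zero> = x" if x: "x \<in> X"
proof -
  note closed = star_closed zero_closed x
  \<comment> \<open>For (B2) both \<open>a\<close> and \<open>(x \<star> \<zero>) \<star> x\<close>
    must vanish. (B3) turns \<open>a \<star> \<zero>\<close> into a square, and
    \<open>\<zero> \<star> a = (a \<star> \<zero>) \<star> a\<close> into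
    \<open>(a \<star> a) \<star> \<zero>\<close>.\<close>
  define a where "a = x \<star> (x \<star> \<zero>)"
  have a: "a \<in> X"
    by (simp add: a_def closed)
  have a0: "a \<star> \<zero> = \<zero>"
    using B3[of x "x \<star> \<zero>" \<zero>] B1[of "x \<star> \<zero>"] by (simp add: a_def closed)
  have "\<zero> \<star> a = \<zero>"
    using B3[of a \<zero> a] a0 B1[of a] B1[of \<zero>] a by (simp add: closed)
  with a0 have "a = \<zero>"
    using B2[of a \<zero>] a by (simp add: closed)
  moreover have "(x \<star> \<zero>) \<star> x = \<zero>"
    using B3[of x \<zero> x] B1[of x] B1[of \<zero>] by (simp add: closed)
  ultimately show ?thesis
    using B2[of "x \<star> \<zero>" x] by (simp add: closed a_def)
qed

lemma GA3_algebra: "GA3_algebra X (\<star>) \<zero>"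
proof
  fix x y z
  assume "x \<in> X" "y \<in> X" "z \<in> X"
  then show "((x \<star> y) \<star> z) \<star> ((x \<star> (z \<star> \<zero>)) \<star> y) = \<zero>"
    using B3[of x y z] B1[of "(x \<star> z) \<star> y"] by (simp add: star_zero star_closed)
qed (rule B2)

end

context GA3_algebra
begin

text \<open>The middle and last arguments of (G) are chosen so that the left factor of the outer
  instance is itself an instance of (G) and collapses to \<open>\<zero>\<close>.\<close>

lemma G_nested_left:
  assumes "x \<in> X" "y \<in> X" "z \<in> X"
  shows "\<zero> \<star> (((x \<star> y) \<star> (((x \<star> (z \<star> \<zero>)) \<star> y) \<star> \<zero>)) \<star> z) = \<zero>"
  using G[of "x \<star> y" z "(x \<star> (z \<star> \<zero>)) \<star> y"] G[of x y z] assms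
  by (simp add: star_closed zero_closed)

text \<open>Here the right factor of the outer instance is the instance of (G) at \<open>x\<close>,
  \<open>y\<close>, \<open>z'\<close>.\<close>

lemma G_nested_right:
  assumes "x \<in> X" "y \<in> X" "z \<in> X"
  shows "(((x \<star> y) \<star> ((x \<star> ((z \<star> \<zero>) \<star> \<zero>)) \<star> y)) \<star> z) \<star> \<zero> = \<zero>"
  using G[of "x \<star> y" "(x \<star> ((z \<star> \<zero>) \<star> \<zero>)) \<star> y" z] G[of x y "z \<star> \<zero>"] assms
  by (simp add: star_closed zero_closed)

text \<open>In the outer instance of (G) the middle argument is \<open>u'\<close> and the last is
  \<open>u = x \<star> y'\<close>, so one inner instance of (G) collapses both factors.\<close>

lemma zero_star_le:
  assumes x: "x \<in> X" and y: "y \<in> X"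
  shows "(\<zero> \<star> (x \<star> (y \<star> \<zero>))) \<star> (\<zero> \<star> ((x \<star> (y \<star> \<zero>)) \<star> \<zero>)) = \<zero>"
  using G[of "(x \<star> \<zero>) \<star> y" "(x \<star> (y \<star> \<zero>)) \<star> \<zero>" "x \<star> (y \<star> \<zero>)"] G[of x \<zero> y] assms
  by (simp add: star_closed zero_closed)

lemma zero_star_zero: "\<zero> \<star> \<zero> = \<zero>"
proof -
  note closed = star_closed zero_closed
  \<comment> \<open>\<open>k\<close> is read off from \<open>G_nested_left\<close> at
    \<open>\<zero>\<close>, which says \<open>\<zero> \<star> k' = \<zero>\<close>; it also has the
    shape \<open>x \<star> y'\<close> that \<open>zero_star_le\<close> requires.\<close>
  define k where "k = (\<zero> \<star> \<zero>) \<star> (((\<zero> \<star> (\<zero> \<star> \<zero>)) \<star> \<zero>) \<star> \<zero>)"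
  have k: "k \<in> X"
    by (simp add: k_def closed)
  have k0: "\<zero> \<star> (k \<star> \<zero>) = \<zero>"
    using G_nested_left[of \<zero> \<zero> \<zero>] by (simp add: k_def closed)
  have zk: "(\<zero> \<star> k) \<star> \<zero> = \<zero>"
    using zero_star_le[of "\<zero> \<star> \<zero>" "(\<zero> \<star> (\<zero> \<star> \<zero>)) \<star> \<zero>", folded k_def] k0
    by (simp add: closed)
  have "\<zero> \<star> (\<zero> \<star> k) = \<zero>"
    using G_nested_left[of \<zero> k k] k0 zk k by (simp add: closed)
  with zk have "\<zero> \<star> k = \<zero>"
    using A3[of "\<zero> \<star> k" \<zero>] k by (simp add: closed)
  with zk show ?thesis
    by simp
qed

lemma star_le_star_zero:
  assumes x: "x \<in> X" and y: "y \<in> X"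
  shows "(x \<star> y) \<star> ((x \<star> \<zero>) \<star> y) = \<zero>"
proof -
  note closed = star_closed zero_closed
  define t where "t a b = (a \<star> b) \<star> ((a \<star> \<zero>) \<star> b)" for a b
  have t: "t a b \<in> X" if "a \<in> X" "b \<in> X" for a b
    using that by (simp add: t_def closed)
  have t2: "(t a b \<star> \<zero>) \<star> \<zero> = \<zero>" if "a \<in> X" "b \<in> X" for a b
    using G_nested_right[of a b \<zero>] that by (simp add: t_def closed zero_star_zero)
  have zt: "\<zero> \<star> t a b = \<zero>" if ab: "a \<in> X" "b \<in> X" for a b
  proof -
    \<comment> \<open>The doubly primed last argument in \<open>G_nested_right\<close> is
      \<open>\<zero>\<close> by \<open>t2\<close>, so only \<open>(\<zero> \<star> t a b)'\<close>
      survives.\<close>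
    have "(\<zero> \<star> t a b) \<star> \<zero> = \<zero>"
      using G_nested_right[of \<zero> \<zero> "t a b"] t2[OF ab] t[OF ab]
      by (simp add: closed zero_star_zero)
    moreover from this have "\<zero> \<star> (\<zero> \<star> t a b) = \<zero>"
      using G[of \<zero> "t a b" \<zero>] t[OF ab] by (simp add: closed zero_star_zero)
    ultimately show ?thesis
      using A3[of "\<zero> \<star> t a b" \<zero>] t[OF ab] by (simp add: closed)
  qed
  \<comment> \<open>Applying \<open>t\<close> to the two factors of \<open>t x y\<close> makes the
    right factor an instance of (G). Thus \<open>zt\<close> also controls \<open>(t x y)'\<close>,
    and (A3) removes the primes from \<open>t2\<close> one at a time.\<close>
  have "t (x \<star> y) ((x \<star> \<zero>) \<star> y) = t x y \<star> \<zero>"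
    using G[of x y \<zero>] x y by (simp add: t_def closed zero_star_zero)
  then have "\<zero> \<star> (t x y \<star> \<zero>) = \<zero>"
    using zt[of "x \<star> y" "(x \<star> \<zero>) \<star> y"] x y by (simp add: closed)
  then have "t x y \<star> \<zero> = \<zero>"
    using A3[of "t x y \<star> \<zero>" \<zero>] t2[OF x y] t[OF x y] by (simp add: closed)
  then have "t x y = \<zero>"
    using A3[of "t x y" \<zero>] zt[OF x y] t[OF x y] by (simp add: closed)
  then show ?thesis
    by (simp add: t_def)
qed

lemma
  assumes x: "x \<in> X"
  shows star_zero3_le: "(((x \<star> \<zero>) \<star> \<zero>) \<star> \<zero>) \<star> x = \<zero>"
    and le_star_zero2_star_zero: "(x \<star> ((x \<star> \<zero>) \<star> \<zero>)) \<star> \<zero> = \<zero>"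
    and star_zero2_le_star_zero: "(((x \<star> \<zero>) \<star> \<zero>) \<star> x) \<star> \<zero> = \<zero>"
proof -
  note closed = star_closed zero_closed x
  have x12: "(x \<star> \<zero>) \<star> ((x \<star> \<zero>) \<star> \<zero>) = \<zero>"
    using star_le_star_zero[of x \<zero>] by (simp add: closed)
  show x02: "(x \<star> ((x \<star> \<zero>) \<star> \<zero>)) \<star> \<zero> = \<zero>"
    using star_le_star_zero[of x "(x \<star> \<zero>) \<star> \<zero>"] x12 by (simp add: closed)
  show x20: "(((x \<star> \<zero>) \<star> \<zero>) \<star> x) \<star> \<zero> = \<zero>"
    using G_nested_right[of x \<zero> x] x02 by (simp add: closed)
  have "((((x \<star> \<zero>) \<star> \<zero>) \<star> \<zero>) \<star> x) \<star> \<zero> = \<zero>"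
    using G_nested_right[of "x \<star> \<zero>" \<zero> x] x12 by (simp add: closed zero_star_zero)
  \<comment> \<open>(G) with last argument \<open>\<zero>\<close> bounds
    \<open>(x'' \<star> x)'\<close>, already \<open>\<zero>\<close>, by
    \<open>x''' \<star> x\<close>.\<close>
  moreover have "\<zero> \<star> ((((x \<star> \<zero>) \<star> \<zero>) \<star> \<zero>) \<star> x) = \<zero>"
    using G[of "(x \<star> \<zero>) \<star> \<zero>" x \<zero>] x20 by (simp add: closed zero_star_zero)
  ultimately show "(((x \<star> \<zero>) \<star> \<zero>) \<star> \<zero>) \<star> x = \<zero>"
    using A3[of "(((x \<star> \<zero>) \<star> \<zero>) \<star> \<zero>) \<star> x" \<zero>] by (simp add: closed)
qed

lemma eq_zero_if_star_zero: "w = \<zero>" if "w \<in> X" "w \<star> \<zero> = \<zero>"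
proof (rule A3)
  show "\<zero> \<star> w = \<zero>"
    using star_zero3_le[OF that(1)] by (simp only: that(2) zero_star_zero)
qed (fact that zero_closed)+

lemma star_zero: "x \<star> \<zero> = x" if x: "x \<in> X"
proof -
  note closed = star_closed zero_closed
  have invol: "(a \<star> \<zero>) \<star> \<zero> = a" if a: "a \<in> X" for a
  proof (rule A3)
    show "((a \<star> \<zero>) \<star> \<zero>) \<star> a = \<zero>"
      by (rule eq_zero_if_star_zero) (simp_all add: closed a star_zero2_le_star_zero)
    show "a \<star> ((a \<star> \<zero>) \<star> \<zero>) = \<zero>"
      by (rule eq_zero_if_star_zero) (simp_all add: closed a le_star_zero2_star_zero)
  qed (simp_all add: closed a)
  have "(x \<star> \<zero>) \<star> x = \<zero>"
    using star_zero3_le[of x] x by (simp add: invol)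
  \<comment> \<open>The instance reads \<open>x'' \<star> x''' = \<zero>\<close>, and
    \<open>invol\<close> cancels pairs of primes.\<close>
  moreover have "x \<star> (x \<star> \<zero>) = \<zero>"
    using star_le_star_zero[of "x \<star> \<zero>" \<zero>] x by (simp add: closed invol)
  ultimately show ?thesis
    using A3[of "x \<star> \<zero>" x] x by (simp add: closed)
qed

lemma BCH_algebra: "BCH_algebra X (\<star>) \<zero>"
proof
  show "x \<star> x = \<zero>" if "x \<in> X" for x
    using G[of x \<zero> \<zero>] that by (simp add: zero_closed star_zero)
  show "x = y" if "x \<in> X" "y \<in> X" "x \<star> y = \<zero>" "y \<star> x = \<zero>" for x y
    using that by (rule A3)
  show "(x \<star> y) \<star> z = (x \<star> z) \<star> y" if "x \<in> X" "y \<in> X" "z \<in> X" for x y z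
    using A3[of "(x \<star> y) \<star> z" "(x \<star> z) \<star> y"] G[of x y z] G[of x z y] that
    by (simp add: star_closed star_zero)
qed

end

text \<open>Both locales include closure, so the equivalence holds for arbitrary carriers and gives
  the equality of classes too.\<close>

lemma BCH_algebra_iff_GA3_algebra: "BCH_algebra X s e \<longleftrightarrow> GA3_algebra X s e"
  by (rule iffI) (rule BCH_algebra.GA3_algebra GA3_algebra.BCH_algebra, assumption)+

theorem theorem1:
  fixes X :: "'a set"
    and star :: "'a \<Rightarrow> 'a \<Rightarrow> 'a"  (infixl \<open>\<star>\<close> 70)
    and zero :: 'a  (\<open>\<zero>\<close>)
  assumes "algebra_2_0 X (\<star>) \<zero>"
  shows "((\<forall>x\<in>X. \<forall>y\<in>X. \<forall>z\<in>X.
             x \<star> x = \<zero> \<and>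
             (x \<star> y = \<zero> \<and> y \<star> x = \<zero> \<longrightarrow> x = y) \<and>
             (x \<star> y) \<star> z = (x \<star> z) \<star> y)
          \<longleftrightarrow>
          (\<forall>x\<in>X. \<forall>y\<in>X. \<forall>z\<in>X.
             ((x \<star> y) \<star> z) \<star> ((x \<star> (z \<star> \<zero>)) \<star> y) = \<zero> \<and>
             (x \<star> y = \<zero> \<and> y \<star> x = \<zero> \<longrightarrow> x = y)))
       \<and> {(Y :: 'a set, s, e). BCH_algebra Y s e} = {(Y, s, e). GA3_algebra Y s e}"
    (is "(?B \<longleftrightarrow> ?G) \<and> _")
proof
  have "?B \<longleftrightarrow> BCH_algebra X (\<star>) \<zero>"
    using assms by (auto simp: BCH_algebra_def BCH_algebra_axioms_def)
  moreover have "?G \<longleftrightarrow> GA3_algebra X (\<star>) \<zero>"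
    using assms by (auto simp: GA3_algebra_def GA3_algebra_axioms_def)
  ultimately show "?B \<longleftrightarrow> ?G"
    by (simp only: BCH_algebra_iff_GA3_algebra)
qed (simp only: BCH_algebra_iff_GA3_algebra)

end
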